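(* Consider a nonlinear network whose node set is split into nonempty sets of central nodes $C$ and boundary nodes $B$, with associated function $K(z)=\sum_{j=1}^m G_j((D^\top z)_j)$, $z=(z_C,z_B)$. Suppose Assumption A (global solvability) and Assumption B (constant reduced graph) hold. Let $\widehat{K}(z_B)=K(z_C(z_B),z_B)$ and let $\widehat{D}$ be the $n_B\times\hat m$ incidence matrix of the Kron reduced graph. If $\ker \widehat{D}=\{0\}$ (i.e. the Kron reduced graph has no cycles), then there exist twice differentiable strongly convex functions $\widehat{G}_j:\mathbb{R}\to\mathbb{R}$, $j=1,\dots,\hat m$, such that the Kron reduced graph endowed with $\widehat{G}_1,\dots,\widehat{G}_{\hat m}$ is a nonlinear network (in particular, its graph is connected) whose associated function is $\widehat{K}$, i.e. $$\widehat{K}(z_B)=\sum_{j=1}^{\hat m}\widehat{G}_j\big((\widehat{D}^\top z_B)_j\big)\quad\text{for all } z_B\in\mathbb{R}^{n_B}.$$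
   Context: Conventions: a twice differentiable function is called strongly convex if its Hessian (second derivative, in the scalar case) is positive definite at every point. The incidence matrix $D$ of a finite directed graph with $n$ nodes and $m$ edges (no self-loops) is the $n\times m$ matrix whose $j$-th column has entry $+1$ at the head node of edge $j$, $-1$ at its tail node, and $0$ elsewhere. Nonlinear network: a connected directed graph with $n\times m$ incidence matrix $D$, where the $j$-th edge is endowed with a twice differentiable strongly convex function $G_j:\mathbb{R}\to\mathbb{R}$, $j=1,\dots,m$. Its associated function is $K:\mathbb{R}^n\to\mathbb{R}$, $K(z):=G(D^\top z)$ with $G(y):=\sum_{j=1}^m G_j(y_j)$. Splitting: the node set is partitioned into nonempty sets of central nodes ($C$) and $n_B$ boundary nodes ($B$), and correspondingly $z=(z_C,z_B)$. Assumption A: there is a differentiable mapping $z_B\mapsto z_C(z_B)$, defined for all $z_B\in\mathbb{R}^{n_B}$, such that $\frac{\partial K}{\partial z_C}(z_C(z_B),z_B)=0$ for all $z_B$. Define $\widehat{K}(z_B):=K(z_C(z_B),z_B)$; it is twice differentiable, and its Hessian at $z_B$ is the Schur complement of the Laplacian matrix $\frac{\partial^2K}{\partial z^2}(z_C(z_B),z_B)$ with respect to its $(C,C)$-block. Kron reduced graph at $z_B$: the graph with node set $B$ having exactly one (arbitrarily oriented) edge between distinct nodes $i,k\in B$ if the $(i,k)$ entry of $\frac{\partial^2\widehat{K}}{\partial z_B^2}(z_B)$ is nonzero, and no edge between them otherwise. Assumption B: the Kron reduced graph is the same for all $z_B$; fixing an orientation, it has incidence matrix $\widehat{D}$ of size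 $n_B\times\hat m$, independent of $z_B$.
   Formalization: For a single boundary node the reduced graph has no edges and the sum is empty, while K̂ may be a nonzero constant (e.g. G_1(y)=y²+1), so the identity is proved up to an additive constant c, with c=0 whenever n_B≥2. *)

theory Defs
  imports "HOL-Analysis.Analysis" "Graph_Theory.Graph_Theory"
begin

text \<open>
  Nodes are the elements of a finite type, so node potentials are vectors in \<open>real ^ 'n\<close>. Edges are
  the elements of the finite set of arcs of a digraph, so parallel edges are allowed and a graph may
  have no edge at all. Edge vectors are functions on the edge type, considered on the arcs only.
\<close>

definition incidence_matrix :: "('n, 'e) pre_digraph \<Rightarrow> 'n \<Rightarrow> 'e \<Rightarrow> real" where
  "incidence_matrix G v j = (if v = head G j then 1 else if v = tail G j then - 1 else 0)"

text \<open>The vector \<open>D\<^sup>T z\<close> for the incidence matrix \<open>D\<close>.\<close>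

definition incidence_transpose_mult :: "('n::finite, 'e) pre_digraph \<Rightarrow> real ^ 'n \<Rightarrow> 'e \<Rightarrow> real" where
  "incidence_transpose_mult G z j = (\<Sum>v\<in>verts G. incidence_matrix G v j * z $ v)"

text \<open>
  Edge vectors are normalized to vanish outside the arcs, so that the kernel is trivial iff it equals
  \<open>{\<lambda>_. 0}\<close>.
\<close>

definition incidence_kernel :: "('n, 'e) pre_digraph \<Rightarrow> ('e \<Rightarrow> real) set" where
  "incidence_kernel G = {y. (\<forall>j. j \<notin> arcs G \<longrightarrow> y j = 0) \<and>
     (\<forall>v\<in>verts G. (\<Sum>j\<in>arcs G. incidence_matrix G v j * y j) = 0)}"

definition twice_differentiable :: "(real \<Rightarrow> real) \<Rightarrow> bool" where
  "twice_differentiable f \<longleftrightarrow>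
     (\<forall>x. f differentiable (at x)) \<and> (\<forall>x. deriv f differentiable (at x))"

definition strongly_convex :: "(real \<Rightarrow> real) \<Rightarrow> bool" where
  "strongly_convex f \<longleftrightarrow> (\<forall>x. deriv (deriv f) x > 0)"

text \<open>\<open>Digraph_Component.connected\<close> is connectedness of the underlying undirected graph.\<close>

definition nonlinear_network :: "('n::finite, 'e) pre_digraph \<Rightarrow> ('e \<Rightarrow> real \<Rightarrow> real) \<Rightarrow> bool" where
  "nonlinear_network G g \<longleftrightarrow>
     fin_digraph G \<and> loopfree_digraph G \<and> verts G = UNIV \<and> Digraph_Component.connected G \<and>
     (\<forall>j\<in>arcs G. twice_differentiable (g j) \<and> strongly_convex (g j))"

definition associated_function ::
    "('n::finite, 'e) pre_digraph \<Rightarrow> ('e \<Rightarrow> real \<Rightarrow> real) \<Rightarrow> real ^ 'n \<Rightarrow> real" where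
  "associated_function G g z = (\<Sum>j\<in>arcs G. g j (incidence_transpose_mult G z j))"

text \<open>
  A splitting of the node set into nonempty sets of central and boundary nodes is represented by the
  node type \<open>'c + 'b\<close>; then \<open>z = (z\<^sub>C, z\<^sub>B)\<close> is the following vector.
\<close>

definition join_vec :: "real ^ 'c \<Rightarrow> real ^ 'b \<Rightarrow> real ^ ('c::finite + 'b::finite)" where
  "join_vec zC zB = (\<chi> i. case i of Inl c \<Rightarrow> zC $ c | Inr b \<Rightarrow> zB $ b)"

text \<open>
  Global solvability: \<open>zC\<close> is a differentiable map, defined everywhere, along which the partial
  derivative of \<open>K\<close> with respect to the central variables vanishes.
\<close>

definition globally_solvable ::
    "(real ^ ('c::finite + 'b::finite) \<Rightarrow> real) \<Rightarrow> (real ^ 'b \<Rightarrow> real ^ 'c) \<Rightarrow> bool" where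
  "globally_solvable K zC \<longleftrightarrow>
     zC differentiable_on UNIV \<and>
     (\<forall>zB. ((\<lambda>x. K (join_vec x zB)) has_derivative (\<lambda>_. 0)) (at (zC zB)))"

definition reduced_function ::
    "(real ^ ('c::finite + 'b::finite) \<Rightarrow> real) \<Rightarrow> (real ^ 'b \<Rightarrow> real ^ 'c) \<Rightarrow> real ^ 'b \<Rightarrow> real" where
  "reduced_function K zC zB = K (join_vec (zC zB) zB)"

definition gradient :: "(real ^ 'n \<Rightarrow> real) \<Rightarrow> real ^ 'n \<Rightarrow> real ^ 'n::finite" where
  "gradient f x = (\<chi> i. frechet_derivative f (at x) (axis i 1))"

definition hessian :: "(real ^ 'n \<Rightarrow> real) \<Rightarrow> real ^ 'n \<Rightarrow> real ^ 'n ^ 'n::finite" where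
  "hessian f x = jacobian (gradient f) (at x)"

text \<open>
  \<open>H\<close> is the Kron reduced graph at \<open>zB\<close>, with an arbitrary orientation and arbitrary edge names.
\<close>

definition kron_reduced_graph ::
    "(real ^ 'b \<Rightarrow> real) \<Rightarrow> real ^ 'b \<Rightarrow> ('b::finite, 'e) pre_digraph \<Rightarrow> bool" where
  "kron_reduced_graph Khat zB H \<longleftrightarrow>
     fin_digraph H \<and> loopfree_digraph H \<and> verts H = UNIV \<and>
     (\<forall>i k. i \<noteq> k \<longrightarrow> card {j \<in> arcs H. {tail H j, head H j} = {i, k}} =
        (if hessian Khat zB $ i $ k \<noteq> 0 then 1 else 0))"

end

theory Submission
  imports Defs
begin

text \<open>
  Write \<open>e\<^sub>j\<close> for the columns of an incidence matrix \<open>D\<close>, so that \<open>(D\<^sup>T z)\<^sub>j = e\<^sub>j \<bullet> z\<close>, let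
  \<open>Z z = (z\<^sub>C(z), z)\<close> be the solution for boundary data \<open>z\<close>, and \<open>M z\<close> its derivative. As
  \<open>\<partial>K/\<partial>z\<^sub>C\<close> vanishes along \<open>Z\<close>, the gradient \<open>F\<close> of the reduced function is the boundary part of
  the gradient of \<open>K\<close> along \<open>Z\<close>, and its derivative \<open>S z\<close>, the Schur complement, satisfies
  \<open>S z h \<bullet> k = \<Sum>\<^sub>j g\<^sub>j''(e\<^sub>j \<bullet> Z z) (e\<^sub>j \<bullet> M z h) (e\<^sub>j \<bullet> M z k)\<close>. From this formula \<open>S z\<close> is symmetric
  and positive semidefinite, and because the network is connected its kernel consists exactly of the
  constant vectors (\<open>reduced_function_derivatives\<close>). A symmetric matrix with zero row sums and the
  sparsity pattern of a graph is a weighted Laplacian of that graph (\<open>laplacian_of_pattern\<close>), so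
  now \<open>S z = D W(z) D\<^sup>T\<close> for the reduced incidence matrix \<open>D\<close>. If \<open>D\<^sup>T h = 0\<close>, then
  \<open>S z h = 0\<close> and \<open>h\<close> is constant; hence the reduced graph is connected.

  The hypothesis \<open>ker D = 0\<close> says that \<open>D\<^sup>T\<close> is onto, so each edge \<open>j\<close> has a dual potential \<open>p\<^sub>j\<close>
  with \<open>e\<^sub>k \<bullet> p\<^sub>j = \<delta>\<^sub>j\<^sub>k\<close> (\<open>dual_potential_exists\<close>; in a tree, the indicator of the head side of \<open>j\<close>
  is one). The weight \<open>w\<^sub>j(z) = S z p\<^sub>j \<bullet> p\<^sub>j\<close> is then positive. Moreover, the derivative of
  \<open>F z \<bullet> p\<^sub>j\<close> in direction \<open>h\<close> is \<open>w\<^sub>j(z) (e\<^sub>j \<bullet> h)\<close>, so \<open>F z \<bullet> p\<^sub>j\<close> depends on \<open>e\<^sub>j \<bullet> z\<close> only. This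
  separates the variables: with \<open>f\<close> the reduced function, \<open>f(z)\<close> and \<open>\<Sum>\<^sub>j f((e\<^sub>j \<bullet> z) p\<^sub>j)\<close> have the
  same gradient, and the edge function \<open>t \<mapsto> f(t p\<^sub>j)\<close> has second derivative
  \<open>w\<^sub>j(t p\<^sub>j) > 0\<close> (\<open>separable_if_hessian_laplacian\<close>). The remaining additive constant is
  distributed over the edges; it survives only for a reduced graph without edges, which by
  connectedness has a single node.
\<close>

section \<open>Potentials on graphs\<close>

definition edge_vector :: "('n::finite, 'e) pre_digraph \<Rightarrow> 'e \<Rightarrow> real ^ 'n" where
  "edge_vector G j = (\<chi> v. incidence_matrix G v j)"

lemma incidence_transpose_mult_eq_inner:
  assumes "verts G = UNIV"
  shows "incidence_transpose_mult G z j = edge_vector G j \<bullet> z"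
  by (simp add: incidence_transpose_mult_def edge_vector_def inner_vec_def assms)

lemma edge_vector_inner:
  fixes z :: "real ^ 'n"
  assumes "tail G j \<noteq> head G j"
  shows "edge_vector G j \<bullet> z = z $ head G j - z $ tail G j"
proof -
  have "edge_vector G j = axis (head G j) 1 - axis (tail G j) 1"
    using assms by (auto simp: edge_vector_def incidence_matrix_def vec_eq_iff axis_def)
  then show ?thesis
    by (simp add: inner_diff_left inner_axis')
qed

lemma edge_vector_nth:
  "edge_vector G j $ v = (if v = head G j then 1 else if v = tail G j then - 1 else 0)"
  by (simp add: edge_vector_def incidence_matrix_def)

lemma edge_vector_inner_one:
  assumes "tail G j \<noteq> head G j"
  shows "edge_vector G j \<bullet> 1 = 0"
  using edge_vector_inner[OF assms, of 1] by simp

text \<open>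
  Connectedness in terms of \<open>ker D\<^sup>T\<close>: a potential without drop on any arc is constant on
  components, and conversely the indicator of a component is such a potential.
\<close>

lemma connected_iff_potentials_constant:
  fixes G :: "('n::finite, 'e) pre_digraph"
  assumes "loopfree_digraph G" and V: "verts G = UNIV"
  shows "Digraph_Component.connected G \<longleftrightarrow>
    (\<forall>z::real ^ 'n. (\<forall>j\<in>arcs G. edge_vector G j \<bullet> z = 0) \<longrightarrow> (\<forall>u v. z $ u = z $ v))"
proof -
  interpret loopfree_digraph G by fact
  have conn: "Digraph_Component.connected G \<longleftrightarrow> (\<forall>u v. (u, v) \<in> ((arcs_ends G)\<^sup>s)\<^sup>*)"
    unfolding connected_conv V
    by (auto intro: rtrancl_on_rtranclI rtrancl_consistent_rtrancl_on)
  have edge: "edge_vector G j \<bullet> z = z $ head G j - z $ tail G j" if "j \<in> arcs G" for j and z :: "real ^ 'n"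
    using that no_loops by (intro edge_vector_inner)
  show ?thesis
    unfolding conn
  proof (intro iffI allI impI)
    fix z :: "real ^ 'n" and u v
    assume r: "\<forall>u v. (u, v) \<in> ((arcs_ends G)\<^sup>s)\<^sup>*" and z: "\<forall>j\<in>arcs G. edge_vector G j \<bullet> z = 0"
    have "(u, v) \<in> ((arcs_ends G)\<^sup>s)\<^sup>*" using r by blast
    then show "z $ u = z $ v"
    proof induction
      case (step x y)
      then have "z $ x = z $ y"
        using z edge by (auto simp: symcl_def arcs_ends_conv)
      with step show ?case by simp
    qed simp
  next
    fix u v
    assume z: "\<forall>z::real ^ 'n. (\<forall>j\<in>arcs G. edge_vector G j \<bullet> z = 0) \<longrightarrow> (\<forall>u v. z $ u = z $ v)"
    define R where "R = {x. (u, x) \<in> ((arcs_ends G)\<^sup>s)\<^sup>*}"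
    define z where "z = ((\<chi> x. if x \<in> R then 1 else 0) :: real ^ 'n)"
    have "head G j \<in> R \<longleftrightarrow> tail G j \<in> R" if "j \<in> arcs G" for j
    proof -
      have "(tail G j, head G j) \<in> (arcs_ends G)\<^sup>s" "(head G j, tail G j) \<in> (arcs_ends G)\<^sup>s"
        using that by (auto simp: symcl_def arcs_ends_conv)
      then show ?thesis unfolding R_def by (auto intro: rtrancl_into_rtrancl)
    qed
    then have "\<forall>j\<in>arcs G. edge_vector G j \<bullet> z = 0"
      using edge by (simp add: z_def)
    with z have "z $ u = z $ v" by blast
    moreover have "u \<in> R" by (simp add: R_def)
    ultimately have "v \<in> R" by (simp add: z_def split: if_splits)
    then show "(u, v) \<in> ((arcs_ends G)\<^sup>s)\<^sup>*" by (simp add: R_def)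
  qed
qed

text \<open>
  Independence of the columns of \<open>D\<close> makes the part of \<open>e\<^sub>j\<close> orthogonal to all other
  columns nonzero; rescaled, this part is the dual vector.
\<close>

lemma dual_potential_exists:
  fixes G :: "('n::finite, 'e) pre_digraph"
  assumes fin: "finite (arcs G)" and V: "verts G = UNIV"
    and ker: "incidence_kernel G = {\<lambda>_. 0}" and j: "j \<in> arcs G"
  obtains p where "\<And>k. k \<in> arcs G \<Longrightarrow> edge_vector G k \<bullet> p = (if k = j then 1 else 0)"
proof -
  let ?I = "arcs G - {j}" and ?e = "edge_vector G"
  obtain y z where y: "y \<in> span (?e ` ?I)"
    and z: "\<And>w. w \<in> span (?e ` ?I) \<Longrightarrow> orthogonal z w" and yz: "?e j = y + z"
    using orthogonal_subspace_decomp_exists[of "?e ` ?I" "?e j"] by metis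
  have "z \<noteq> 0"
  proof
    assume "z = 0"
    let ?C = "{x. \<exists>c. x = (\<Sum>k\<in>?I. c k *\<^sub>R ?e k)}"
    have "subspace ?C"
      unfolding subspace_def
    proof safe
      show "\<exists>c. 0 = (\<Sum>k\<in>?I. c k *\<^sub>R ?e k)" by (rule exI[of _ "\<lambda>_. 0"]) simp
      fix c d
      show "\<exists>b. (\<Sum>k\<in>?I. c k *\<^sub>R ?e k) + (\<Sum>k\<in>?I. d k *\<^sub>R ?e k) = (\<Sum>k\<in>?I. b k *\<^sub>R ?e k)"
        by (rule exI[of _ "\<lambda>k. c k + d k"]) (simp add: sum.distrib scaleR_left_distrib)
      fix r
      show "\<exists>b. r *\<^sub>R (\<Sum>k\<in>?I. c k *\<^sub>R ?e k) = (\<Sum>k\<in>?I. b k *\<^sub>R ?e k)"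
        by (rule exI[of _ "\<lambda>k. r * c k"]) (simp add: scaleR_right.sum)
    qed
    moreover have "?e ` ?I \<subseteq> ?C"
    proof safe
      fix k assume "k \<in> arcs G" "k \<noteq> j"
      then have "?e k = (\<Sum>l\<in>?I. (if l = k then 1 else 0) *\<^sub>R ?e l)"
        using fin by (simp add: if_distrib[of "\<lambda>x. x *\<^sub>R _"] cong: if_cong)
      then show "\<exists>c. ?e k = (\<Sum>l\<in>?I. c l *\<^sub>R ?e l)" by (rule exI[of _ "\<lambda>l. if l = k then 1 else 0"])
    qed
    ultimately have "y \<in> ?C" using span_minimal y by blast
    then obtain c where c: "?e j = (\<Sum>k\<in>?I. c k *\<^sub>R ?e k)" using yz \<open>z = 0\<close> by auto
    \<comment> \<open>A dependence of \<open>e\<^sub>j\<close> on the other columns is a nonzero kernel vector.\<close>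
    define x where "x k = (if k = j then - 1 else if k \<in> arcs G then c k else 0)" for k
    have "(\<Sum>k\<in>arcs G. x k *\<^sub>R ?e k) = x j *\<^sub>R ?e j + (\<Sum>k\<in>?I. x k *\<^sub>R ?e k)"
      using fin j by (rule sum.remove)
    also have "(\<Sum>k\<in>?I. x k *\<^sub>R ?e k) = (\<Sum>k\<in>?I. c k *\<^sub>R ?e k)"
      by (rule sum.cong) (auto simp: x_def)
    finally have 0: "(\<Sum>k\<in>arcs G. x k *\<^sub>R ?e k) = 0" using c by (simp add: x_def)
    have "(\<Sum>k\<in>arcs G. incidence_matrix G v k * x k) = 0" for v
      using arg_cong[OF 0, of "\<lambda>w. w $ v"] by (simp add: edge_vector_def mult.commute)
    then have "x \<in> incidence_kernel G"
      using j by (auto simp: incidence_kernel_def x_def)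
    then have "x j = 0" using ker by simp
    then show False by (simp add: x_def)
  qed
  show thesis
  proof (rule that[of "z /\<^sub>R (z \<bullet> z)"])
    fix k assume k: "k \<in> arcs G"
    show "?e k \<bullet> (z /\<^sub>R (z \<bullet> z)) = (if k = j then 1 else 0)"
    proof (cases "k = j")
      case True
      have "?e j \<bullet> z = z \<bullet> z"
        using z[OF y] by (simp add: yz inner_add_left inner_add_right orthogonal_def inner_commute)
      with True \<open>z \<noteq> 0\<close> show ?thesis by simp
    next
      case False
      with k have "?e k \<in> span (?e ` ?I)" by (intro span_base) auto
      from z[OF this] False show ?thesis by (simp add: orthogonal_def inner_commute)
    qed
  qed
qed

section \<open>Weighted Laplacians\<close>

text \<open>The operator \<open>D W D\<^sup>T\<close> for \<open>W = diag w\<close>.\<close>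

definition laplacian :: "('n::finite, 'e) pre_digraph \<Rightarrow> ('e \<Rightarrow> real) \<Rightarrow> real ^ 'n \<Rightarrow> real ^ 'n" where
  "laplacian G w h = (\<Sum>j\<in>arcs G. (w j * (edge_vector G j \<bullet> h)) *\<^sub>R edge_vector G j)"

lemma laplacian_inner:
  "laplacian G w h \<bullet> k = (\<Sum>j\<in>arcs G. w j * (edge_vector G j \<bullet> h) * (edge_vector G j \<bullet> k))"
  by (simp add: laplacian_def inner_sum_left)

lemma laplacian_definite:
  assumes "finite (arcs G)" and "\<And>j. j \<in> arcs G \<Longrightarrow> w j > 0" 
  shows "laplacian G w h \<bullet> h \<ge> 0"
    and "laplacian G w h \<bullet> h = 0 \<longleftrightarrow> (\<forall>j\<in>arcs G. edge_vector G j \<bullet> h = 0)"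
proof -
  have nn: "w j * (edge_vector G j \<bullet> h) * (edge_vector G j \<bullet> h) \<ge> 0" if "j \<in> arcs G" for j
    using assms(2)[OF that] by (simp add: mult.assoc)
  then show "laplacian G w h \<bullet> h \<ge> 0" unfolding laplacian_inner by (rule sum_nonneg)
  have "w j \<noteq> 0" if "j \<in> arcs G" for j using assms(2)[OF that] by simp
  then show "laplacian G w h \<bullet> h = 0 \<longleftrightarrow> (\<forall>j\<in>arcs G. edge_vector G j \<bullet> h = 0)"
    unfolding laplacian_inner by (subst sum_nonneg_eq_0_iff[OF assms(1) nn]) auto
qed

text \<open>
  As the rows sum to zero, \<open>(A h)\<^sub>i = \<Sum>\<^sub>k A\<^sub>i\<^sub>k (h\<^sub>k - h\<^sub>i)\<close>, and the pattern says that each nonzero term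
  belongs to exactly one edge. Symmetry makes the contribution of an edge to its two end nodes
  opposite, as required by the column \<open>e\<^sub>j\<close>.
\<close>

lemma laplacian_of_pattern:
  fixes A :: "real ^ 'n ^ 'n::finite" and H :: "('n, 'e) pre_digraph"
  assumes sym: "\<And>i k. A $ i $ k = A $ k $ i" and rows: "A *v 1 = 0"
    and H: "finite (arcs H)" "\<And>j. j \<in> arcs H \<Longrightarrow> tail H j \<noteq> head H j"
    and pattern: "\<And>i k. i \<noteq> k \<Longrightarrow>
      card {j \<in> arcs H. {tail H j, head H j} = {i, k}} = (if A $ i $ k \<noteq> 0 then 1 else 0)"
  shows "A *v h = laplacian H (\<lambda>j. - A $ tail H j $ head H j) h"
proof (subst vec_eq_iff, rule allI)
  fix i
  let ?T = "\<lambda>k. A $ i $ k * (h $ k - h $ i)"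
  let ?P = "\<lambda>j k. {tail H j, head H j} = {i, k}"
  have term_eq: "(- A $ tail H j $ head H j * (edge_vector H j \<bullet> h)) * edge_vector H j $ i
      = (\<Sum>k\<in>UNIV. if ?P j k then ?T k else 0)" if j: "j \<in> arcs H" for j
  proof -
    have ne: "tail H j \<noteq> head H j" using H(2)[OF j] .
    consider "i = head H j" | "i = tail H j" | "i \<noteq> head H j" "i \<noteq> tail H j" by blast
    then show ?thesis
    proof cases
      case 1
      then have "?P j k \<longleftrightarrow> k = tail H j" for k using ne by auto
      then show ?thesis using 1 ne sym[of "head H j" "tail H j"]
        by (simp add: edge_vector_inner edge_vector_nth algebra_simps)
    next
      case 2
      then have "?P j k \<longleftrightarrow> k = head H j" for k using ne by (auto simp: doubleton_eq_iff)
      then show ?thesis using 2 ne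
        by (simp add: edge_vector_inner edge_vector_nth algebra_simps)
    next
      case 3
      then have "\<not> ?P j k" for k by auto
      with 3 show ?thesis by (simp add: edge_vector_nth)
    qed
  qed
  have "laplacian H (\<lambda>j. - A $ tail H j $ head H j) h $ i
      = (\<Sum>j\<in>arcs H. \<Sum>k\<in>UNIV. if ?P j k then ?T k else 0)"
    using term_eq by (simp add: laplacian_def)
  also have "\<dots> = (\<Sum>k\<in>UNIV. \<Sum>j\<in>arcs H. if ?P j k then ?T k else 0)"
    by (rule sum.swap)
  also have "\<dots> = (\<Sum>k\<in>UNIV. card {j \<in> arcs H. ?P j k} * ?T k)"
    using H(1) by (simp add: sum.If_cases Int_def)
  also have "\<dots> = (\<Sum>k\<in>UNIV. ?T k)"
  proof (rule sum.cong[OF refl])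
    fix k show "card {j \<in> arcs H. ?P j k} * ?T k = ?T k"
      by (cases "i = k") (simp_all add: pattern)
  qed
  also have "\<dots> = (A *v h) $ i - (A *v 1) $ i * h $ i"
    by (simp add: matrix_vector_mult_def algebra_simps sum_subtractf sum_distrib_left)
  finally show "(A *v h) $ i = laplacian H (\<lambda>j. - A $ tail H j $ head H j) h $ i"
    by (simp add: rows)
qed


section \<open>The associated function\<close>

lemma associated_function_eq:
  assumes "verts G = UNIV"
  shows "associated_function G g z = (\<Sum>j\<in>arcs G. g j (edge_vector G j \<bullet> z))"
  by (simp add: associated_function_def incidence_transpose_mult_eq_inner[OF assms])

definition associated_gradient ::
    "('n::finite, 'e) pre_digraph \<Rightarrow> ('e \<Rightarrow> real \<Rightarrow> real) \<Rightarrow> real ^ 'n \<Rightarrow> real ^ 'n" where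
  "associated_gradient G g z =
     (\<Sum>j\<in>arcs G. deriv (g j) (edge_vector G j \<bullet> z) *\<^sub>R edge_vector G j)"

lemma twice_differentiable_has_derivs:
  assumes "twice_differentiable f"
  shows "(f has_real_derivative deriv f x) (at x)"
    and "(deriv f has_real_derivative deriv (deriv f) x) (at x)"
  using assms by (simp_all add: twice_differentiable_def DERIV_deriv_iff_real_differentiable)

lemma associated_function_has_derivative:
  assumes "verts G = UNIV" and "\<And>j. j \<in> arcs G \<Longrightarrow> twice_differentiable (g j)"
  shows "(associated_function G g has_derivative (\<lambda>h. associated_gradient G g z \<bullet> h)) (at z)"
proof -
  have "((\<lambda>z. g j (edge_vector G j \<bullet> z)) has_derivative
      (\<lambda>h. deriv (g j) (edge_vector G j \<bullet> z) *\<^sub>R edge_vector G j \<bullet> h)) (at z)" if "j \<in> arcs G" for j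
    by (rule has_derivative_eq_rhs[OF DERIV_compose_FDERIV[OF
          twice_differentiable_has_derivs(1)[OF assms(2)[OF that]]
          has_derivative_inner_right[OF has_derivative_ident]]])
      (simp add: fun_eq_iff mult.commute)
  then show ?thesis
    unfolding associated_function_eq[OF assms(1), abs_def] associated_gradient_def inner_sum_left
    by (rule has_derivative_sum)
qed

lemma associated_gradient_has_derivative:
  assumes "\<And>j. j \<in> arcs G \<Longrightarrow> twice_differentiable (g j)"
  shows "(associated_gradient G g has_derivative
    laplacian G (\<lambda>j. deriv (deriv (g j)) (edge_vector G j \<bullet> z))) (at z)"
proof -
  have "((\<lambda>z. deriv (g j) (edge_vector G j \<bullet> z) *\<^sub>R edge_vector G j) has_derivative
      (\<lambda>h. (deriv (deriv (g j)) (edge_vector G j \<bullet> z) * (edge_vector G j \<bullet> h)) *\<^sub>R edge_vector G j)) (at z)"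
    if "j \<in> arcs G" for j
    by (rule has_derivative_scaleR_left, rule has_derivative_eq_rhs[OF DERIV_compose_FDERIV[OF
          twice_differentiable_has_derivs(2)[OF assms[OF that]]
          has_derivative_inner_right[OF has_derivative_ident]]])
      (simp add: fun_eq_iff mult.commute)
  then show ?thesis
    unfolding associated_gradient_def[abs_def] laplacian_def[abs_def]
    by (rule has_derivative_sum)
qed

lemma associated_gradient_inner_one:
  assumes "\<And>j. j \<in> arcs G \<Longrightarrow> tail G j \<noteq> head G j"
  shows "associated_gradient G g z \<bullet> 1 = 0"
  using assms by (simp add: associated_gradient_def inner_sum_left edge_vector_inner_one)

section \<open>Eliminating the central variables\<close>

definition central_part :: "real ^ ('c::finite + 'b::finite) \<Rightarrow> real ^ 'c" where
  "central_part z = (\<chi> c. z $ Inl c)"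

definition boundary_part :: "real ^ ('c::finite + 'b::finite) \<Rightarrow> real ^ 'b" where
  "boundary_part z = (\<chi> b. z $ Inr b)"

lemma join_vec_inner:
  "join_vec x h \<bullet> y = x \<bullet> central_part y + h \<bullet> boundary_part y"
  by (simp add: inner_vec_def join_vec_def central_part_def boundary_part_def
      UNIV_Plus_UNIV[symmetric] sum.Plus del: UNIV_Plus_UNIV)

lemma join_vec_one: "join_vec 1 1 = 1"
  by (auto simp: vec_eq_iff join_vec_def split: sum.split)

lemma bounded_linear_central_part: "bounded_linear central_part"
  by (rule linear_conv_bounded_linear[THEN iffD1], rule linearI)
    (simp_all add: central_part_def vec_eq_iff)

lemma bounded_linear_boundary_part: "bounded_linear boundary_part"
  by (rule linear_conv_bounded_linear[THEN iffD1], rule linearI)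
    (simp_all add: boundary_part_def vec_eq_iff)

lemma has_derivative_join_vec:
  assumes "(f has_derivative f') (at x)" "(g has_derivative g') (at x)"
  shows "((\<lambda>x. join_vec (f x) (g x)) has_derivative (\<lambda>h. join_vec (f' h) (g' h))) (at x)"
proof -
  have "linear (\<lambda>p. join_vec (fst p) (snd p))"
    by (rule linearI) (auto simp: join_vec_def vec_eq_iff split: sum.split)
  then have "bounded_linear (\<lambda>p. join_vec (fst p) (snd p))"
    by (rule linear_conv_bounded_linear[THEN iffD1])
  from bounded_linear.has_derivative[OF this has_derivative_Pair[OF assms]] show ?thesis by simp
qed

text \<open>
  The central parts of the gradient of \<open>K\<close> and of its derivative vanish along the solution, so in
  inner products with them the central components of the other factor may be chosen freely.
  Completing \<open>k\<close> to \<open>M z k\<close> shows that the Schur complement inherits symmetry and semidefiniteness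
  from the Laplacian of the network. Completing the boundary vector \<open>1\<close> to the constant
  vector on all nodes, which every edge annihilates, gives the statements about \<open>1\<close>.
\<close>

lemma reduced_function_derivatives:
  fixes G :: "('c::finite + 'b::finite, 'e) pre_digraph"
    and zC :: "real ^ 'b \<Rightarrow> real ^ 'c"
  assumes network: "nonlinear_network G g"
    and solvable: "globally_solvable (associated_function G g) zC"
  obtains F :: "real ^ 'b \<Rightarrow> real ^ 'b" and S :: "real ^ 'b \<Rightarrow> real ^ 'b \<Rightarrow> real ^ 'b"
  where "\<And>z. (reduced_function (associated_function G g) zC has_derivative (\<lambda>h. F z \<bullet> h)) (at z)"
    and "\<And>z. (F has_derivative S z) (at z)"
    and "\<And>z. F z \<bullet> 1 = 0"
    and "\<And>z. S z 1 = 0"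
    and "\<And>z h k. S z h \<bullet> k = S z k \<bullet> h"
    and "\<And>z h. S z h \<bullet> h \<ge> 0"
    and "\<And>z h u v. S z h \<bullet> h = 0 \<Longrightarrow> h $ u = h $ v"
proof -
  interpret fin_digraph G using network by (simp add: nonlinear_network_def)
  interpret loopfree_digraph G using network by (simp add: nonlinear_network_def)
  have V: "verts G = UNIV" and conn: "Digraph_Component.connected G"
    and twice: "\<And>j. j \<in> arcs G \<Longrightarrow> twice_differentiable (g j)"
    and convex: "\<And>j x. j \<in> arcs G \<Longrightarrow> deriv (deriv (g j)) x > 0"
    using network by (auto simp: nonlinear_network_def strongly_convex_def)
  let ?K = "associated_function G g" and ?dK = "associated_gradient G g"
  define Z where "Z z = join_vec (zC z) z" for z
  define M where "M z h = join_vec (frechet_derivative zC (at z) h) h" for z h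
  define L where "L z = laplacian G (\<lambda>j. deriv (deriv (g j)) (edge_vector G j \<bullet> Z z))" for z
  define F where "F z = boundary_part (?dK (Z z))" for z
  define S where "S z h = boundary_part (L z (M z h))" for z h
  have zC: "(zC has_derivative frechet_derivative zC (at z)) (at z)" for z
    using solvable by (simp add: globally_solvable_def differentiable_on_def frechet_derivative_works)
  have Z: "(Z has_derivative M z) (at z)" for z
    unfolding Z_def[abs_def] M_def[abs_def] by (rule has_derivative_join_vec[OF zC has_derivative_ident])
  have K: "(?K has_derivative (\<lambda>h. ?dK z \<bullet> h)) (at z)" for z
    by (rule associated_function_has_derivative[OF V twice])
  have dK: "((\<lambda>z. ?dK (Z z)) has_derivative (\<lambda>h. L z (M z h))) (at z)" for z
    unfolding L_def by (rule has_derivative_compose[OF Z associated_gradient_has_derivative[OF twice]])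

  have central_dK: "central_part (?dK (Z z)) = 0" for z
  proof -
    have "((\<lambda>x. ?K (join_vec x z)) has_derivative (\<lambda>x. ?dK (Z z) \<bullet> join_vec x 0)) (at (zC z))"
      unfolding Z_def
      by (rule has_derivative_compose[OF has_derivative_join_vec[OF has_derivative_ident has_derivative_const] K])
    moreover have "((\<lambda>x. ?K (join_vec x z)) has_derivative (\<lambda>_. 0)) (at (zC z))"
      using solvable by (simp add: globally_solvable_def)
    ultimately have "(\<lambda>x. ?dK (Z z) \<bullet> join_vec x 0) = (\<lambda>_. 0)"
      by (rule has_derivative_unique)
    then have "?dK (Z z) \<bullet> join_vec (central_part (?dK (Z z))) 0 = 0" by meson
    then show ?thesis by (simp add: inner_commute[of "?dK _"] join_vec_inner)
  qed
  have central_L: "central_part (L z (M z h)) = 0" for z h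
  proof -
    have "((\<lambda>z. central_part (?dK (Z z))) has_derivative (\<lambda>h. central_part (L z (M z h)))) (at z)"
      by (rule bounded_linear.has_derivative[OF bounded_linear_central_part dK])
    then have "(\<lambda>h. central_part (L z (M z h))) = (\<lambda>_. 0)"
      unfolding central_dK by (rule has_derivative_unique) (rule has_derivative_const)
    then show ?thesis by meson
  qed
  \<comment> \<open>The central components \<open>x\<close> are free here.\<close>
  have S_inner: "S z h \<bullet> k = L z (M z h) \<bullet> join_vec x k" for z h k x
    by (simp add: S_def inner_commute[of _ "join_vec x k"] join_vec_inner central_L)
      (rule inner_commute)
  have edges: "edge_vector G j \<bullet> M z h = 0" if "L z (M z h) \<bullet> M z h = 0" "j \<in> arcs G" for z h j
    using laplacian_definite(2)[of G "\<lambda>j. deriv (deriv (g j)) (edge_vector G j \<bullet> Z z)" "M z h"]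
      convex that unfolding L_def by simp
  have S_M: "S z h \<bullet> k = L z (M z h) \<bullet> M z k" for z h k
    unfolding M_def[of z k] by (rule S_inner)
  have L_sym: "L z h \<bullet> k = L z k \<bullet> h" for z h k
    by (simp add: L_def laplacian_inner mult_ac)
  have L_one: "L z 1 = 0" for z
    using no_loops by (simp add: L_def laplacian_def edge_vector_inner_one)
  show thesis
  proof (rule that[of F S])
    fix z :: "real ^ 'b" and h k and u v
    have F_inner: "?dK (Z z) \<bullet> join_vec x h = F z \<bullet> h" for x h
      by (simp add: F_def inner_commute[of _ "join_vec x h"] join_vec_inner central_dK)
        (rule inner_commute)
    show "(reduced_function ?K zC has_derivative (\<lambda>h. F z \<bullet> h)) (at z)"
      using has_derivative_compose[OF Z K, of z]
      by (simp add: reduced_function_def[abs_def] Z_def[symmetric] M_def F_inner)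
    show "(F has_derivative S z) (at z)"
      unfolding F_def[abs_def] S_def[abs_def]
      by (rule bounded_linear.has_derivative[OF bounded_linear_boundary_part dK])
    show "F z \<bullet> 1 = 0"
      using F_inner[of 1 1] associated_gradient_inner_one[of G g "Z z"] no_loops by (simp add: join_vec_one)
    show "S z h \<bullet> k = S z k \<bullet> h"
      unfolding S_M by (rule L_sym)
    show "S z h \<bullet> h \<ge> 0"
      unfolding S_M L_def using convex by (intro laplacian_definite(1)) auto
    \<comment> \<open>\<open>M z 1\<close> and \<open>1\<close> differ in central components only, where \<open>L z (M z 1)\<close> vanishes.\<close>
    have "L z (M z 1) \<bullet> M z 1 = L z (M z 1) \<bullet> 1"
      using S_M[of z 1 1] S_inner[of z 1 1 1] by (simp add: join_vec_one)
    also have "\<dots> = 0" using L_sym[of z "M z 1" 1] by (simp add: L_one)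
    finally have "\<forall>j\<in>arcs G. edge_vector G j \<bullet> M z 1 = 0" using edges by blast
    then have "L z (M z 1) = 0" by (simp add: L_def laplacian_def)
    then show "S z 1 = 0"
      by (simp add: S_def boundary_part_def vec_eq_iff)
    assume "S z h \<bullet> h = 0"
    then have "\<forall>j\<in>arcs G. edge_vector G j \<bullet> M z h = 0" unfolding S_M using edges by blast
    with conn have "M z h $ Inr u = M z h $ Inr v"
      unfolding connected_iff_potentials_constant[OF loopfree_digraph_axioms V] by blast
    then show "h $ u = h $ v" by (simp add: M_def join_vec_def)
  qed
qed

section \<open>Separation of variables along a tree\<close>

text \<open>
  When the Hessian of \<open>f\<close> is a Laplacian at every point, the coordinates \<open>e\<^sub>j \<bullet> z\<close> diagonalize it,
  the \<open>p\<^sub>j\<close> being the corresponding directions. A function whose mixed second derivatives vanish is a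
  sum of functions of one coordinate each. Together with the constant vector, along which \<open>f\<close> does
  not change, the \<open>p\<^sub>j\<close> span the whole space. The exceptional constant is \<open>f\<close> itself in the
  absence of edges.
\<close>

lemma separable_if_hessian_laplacian:
  fixes H :: "('n::finite, 'e) pre_digraph" and f :: "real ^ 'n \<Rightarrow> real"
  assumes H: "fin_digraph H" "loopfree_digraph H" "verts H = UNIV" "Digraph_Component.connected H"
    and ker: "incidence_kernel H = {\<lambda>_. 0}"
    and f: "\<And>z. (f has_derivative (\<lambda>h. F z \<bullet> h)) (at z)"
    and F: "\<And>z. (F has_derivative laplacian H (w z)) (at z)"
    and F_one: "\<And>z. F z \<bullet> 1 = 0"
    and w: "\<And>z j. j \<in> arcs H \<Longrightarrow> w z j > 0"
  obtains gh where "nonlinear_network H gh"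
    and "\<And>z. f z = (if arcs H = {} then f 0 else 0) + associated_function H gh z"
proof -
  interpret fin_digraph H by fact
  interpret loopfree_digraph H by fact
  let ?e = "edge_vector H"
  define p where "p j = (SOME p. \<forall>k\<in>arcs H. ?e k \<bullet> p = (if k = j then 1 else 0))" for j
  have p: "?e k \<bullet> p j = (if k = j then 1 else 0)" if "j \<in> arcs H" "k \<in> arcs H" for j k
  proof -
    have "\<exists>p. \<forall>k\<in>arcs H. ?e k \<bullet> p = (if k = j then 1 else 0)"
      using dual_potential_exists[OF finite_arcs H(3) ker that(1)] by metis
    from someI_ex[OF this] that(2) show ?thesis unfolding p_def by blast
  qed
  have dF: "((\<lambda>z. F z \<bullet> p j) has_derivative (\<lambda>h. w z j * (?e j \<bullet> h))) (at z)" if j: "j \<in> arcs H" for j z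
  proof (rule has_derivative_eq_rhs[OF has_derivative_inner_left[OF F]])
    show "(\<lambda>h. laplacian H (w z) h \<bullet> p j) = (\<lambda>h. w z j * (?e j \<bullet> h))"
    proof
      fix h
      have "laplacian H (w z) h \<bullet> p j = (\<Sum>k\<in>arcs H. if k = j then w z j * (?e j \<bullet> h) else 0)"
        unfolding laplacian_inner by (rule sum.cong) (simp_all add: p[OF j])
      then show "laplacian H (w z) h \<bullet> p j = w z j * (?e j \<bullet> h)" using j by simp
    qed
  qed
  \<comment> \<open>The segment from \<open>(e\<^sub>j \<bullet> z) p\<^sub>j\<close> to \<open>z\<close> keeps the potential drop at \<open>j\<close> fixed, and so \<open>F \<bullet> p\<^sub>j\<close>.\<close>
  have along: "F ((?e j \<bullet> z) *\<^sub>R p j) \<bullet> p j = F z \<bullet> p j" if j: "j \<in> arcs H" for j z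
  proof -
    let ?x = "(?e j \<bullet> z) *\<^sub>R p j"
    have "?e j \<bullet> (z - ?x) = 0" using p[OF j j] by (simp add: inner_diff_right)
    moreover have "((\<lambda>t. F (?x + t *\<^sub>R (z - ?x)) \<bullet> p j) has_derivative
        (\<lambda>s. w (?x + t *\<^sub>R (z - ?x)) j * (?e j \<bullet> (s *\<^sub>R (z - ?x))))) (at t)" for t :: real
      by (rule has_derivative_compose[OF _ dF[OF j]]) (auto intro!: derivative_eq_intros)
    ultimately have "((\<lambda>t. F (?x + t *\<^sub>R (z - ?x)) \<bullet> p j) has_derivative (\<lambda>s. 0)) (at t)" for t :: real
      by simp
    then obtain c where "\<And>t::real. F (?x + t *\<^sub>R (z - ?x)) \<bullet> p j = c"
      using has_derivative_zero_constant[of UNIV "\<lambda>t::real. F (?x + t *\<^sub>R (z - ?x)) \<bullet> p j"] by auto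
    from this[of 0] this[of 1] show ?thesis by simp
  qed
  \<comment> \<open>The constants make the values \<open>gh j 0\<close> add up to \<open>f 0\<close> as soon as there is an edge.\<close>
  define gh where "gh j t = f (t *\<^sub>R p j) - f 0 + f 0 / card (arcs H)" for j and t :: real
  have d1: "(gh j has_real_derivative F (t *\<^sub>R p j) \<bullet> p j) (at t)" for j t
  proof -
    have "((\<lambda>t. f (t *\<^sub>R p j)) has_derivative (\<lambda>s. F (t *\<^sub>R p j) \<bullet> (s *\<^sub>R p j))) (at t)"
      by (rule has_derivative_compose[OF _ f]) (auto intro!: derivative_eq_intros)
    then have "((\<lambda>t. f (t *\<^sub>R p j)) has_real_derivative F (t *\<^sub>R p j) \<bullet> p j) (at t)"
      by (rule has_derivative_imp_has_field_derivative) simp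
    then show ?thesis unfolding gh_def[abs_def] by (auto intro!: derivative_eq_intros)
  qed
  then have deriv_gh: "deriv (gh j) = (\<lambda>t. F (t *\<^sub>R p j) \<bullet> p j)" for j
    by (intro ext DERIV_imp_deriv)
  have d2: "(deriv (gh j) has_real_derivative w (t *\<^sub>R p j) j) (at t)" if j: "j \<in> arcs H" for j t
  proof -
    have "((\<lambda>t. F (t *\<^sub>R p j) \<bullet> p j) has_derivative (\<lambda>s. w (t *\<^sub>R p j) j * (?e j \<bullet> (s *\<^sub>R p j)))) (at t)"
      by (rule has_derivative_compose[OF _ dF[OF j]]) (auto intro!: derivative_eq_intros)
    then show ?thesis unfolding deriv_gh using p[OF j j] by (simp add: has_field_derivative_def)
  qed
  show thesis
  proof (rule that[of gh])
    have "twice_differentiable (gh j) \<and> strongly_convex (gh j)" if j: "j \<in> arcs H" for j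
      using d1[of j] d2[OF j] w[OF j] DERIV_imp_deriv[OF d2[OF j]]
      unfolding twice_differentiable_def strongly_convex_def real_differentiable_def
      by auto
    then show "nonlinear_network H gh" using H by (simp add: nonlinear_network_def)
    fix z
    let ?\<Phi> = "\<lambda>z. f z - (\<Sum>j\<in>arcs H. gh j (?e j \<bullet> z))"
    have "(?\<Phi> has_derivative (\<lambda>h. 0)) (at z)" for z
    proof -
      have "((\<lambda>z. gh j (?e j \<bullet> z)) has_derivative (\<lambda>h. (F z \<bullet> p j) * (?e j \<bullet> h))) (at z)"
        if j: "j \<in> arcs H" for j
        by (rule has_derivative_eq_rhs[OF DERIV_compose_FDERIV[OF d1
              has_derivative_inner_right[OF has_derivative_ident]]])
          (simp add: fun_eq_iff along[OF j] mult.commute)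
      from has_derivative_diff[OF f has_derivative_sum[of "arcs H", OF this]]
      have "(?\<Phi> has_derivative (\<lambda>h. F z \<bullet> h - (\<Sum>j\<in>arcs H. (F z \<bullet> p j) * (?e j \<bullet> h)))) (at z)" .
      moreover have "F z \<bullet> h - (\<Sum>j\<in>arcs H. (F z \<bullet> p j) * (?e j \<bullet> h)) = 0" for h
      proof -
        \<comment> \<open>Removing all potential drops of \<open>h\<close> leaves a constant vector, which \<open>F z\<close> annihilates.\<close>
        define d where "d = h - (\<Sum>j\<in>arcs H. (?e j \<bullet> h) *\<^sub>R p j)"
        have "?e k \<bullet> d = 0" if k: "k \<in> arcs H" for k
        proof -
          have "(\<Sum>j\<in>arcs H. (?e j \<bullet> h) * (?e k \<bullet> p j)) = (\<Sum>j\<in>arcs H. if k = j then ?e k \<bullet> h else 0)"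
            by (rule sum.cong) (simp_all add: p k)
          then show ?thesis using k by (simp add: d_def inner_diff_right inner_sum_right)
        qed
        with H(4) have "d $ u = d $ v" for u v
          unfolding connected_iff_potentials_constant[OF H(2,3)] by blast
        then have "d = (d $ undefined) *\<^sub>R 1" by (simp add: vec_eq_iff)
        then have "F z \<bullet> d = 0" using F_one[of z] by (metis inner_scaleR_right mult_zero_right)
        then show ?thesis by (simp add: d_def inner_diff_right inner_sum_right mult.commute)
      qed
      ultimately show ?thesis by simp
    qed
    then obtain c where c: "\<And>z. ?\<Phi> z = c"
      using has_derivative_zero_constant[of UNIV ?\<Phi>] by auto
    from c[of z] c[of 0] show "f z = (if arcs H = {} then f 0 else 0) + associated_function H gh z"
      by (auto simp: associated_function_eq[OF H(3)] gh_def[of _ 0] card_gt_0_iff split: if_splits)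
  qed
qed

section \<open>Kron reduction to an acyclic graph\<close>

lemma gradient_eqI:
  assumes "\<And>z. (f has_derivative (\<lambda>h. F z \<bullet> h)) (at z)"
  shows "gradient f = F"
  by (simp add: fun_eq_iff gradient_def frechet_derivative_at[OF assms, symmetric] vec_eq_iff inner_axis)

theorem theorem2p9:
  fixes G :: "('c::finite + 'b::finite, 'e) pre_digraph"
    and g :: "'e \<Rightarrow> real \<Rightarrow> real"
    and K :: "real ^ ('c + 'b) \<Rightarrow> real"
    and zC :: "real ^ 'b \<Rightarrow> real ^ 'c"
    and Khat :: "real ^ 'b \<Rightarrow> real"
    and H :: "('b, 'f) pre_digraph"
  assumes network: "nonlinear_network G g"
    and K: "K = associated_function G g"
    and assumption_A: "globally_solvable K zC"
    and Khat: "Khat = reduced_function K zC"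
    and assumption_B: "\<forall>zB. kron_reduced_graph Khat zB H"
    and kernel: "incidence_kernel H = {\<lambda>_. 0}"
  shows "\<exists>ghat c. nonlinear_network H ghat \<and>
           (\<forall>zB. Khat zB = c + associated_function H ghat zB) \<and>
           (2 \<le> CARD('b) \<longrightarrow> c = 0)"
proof -
  obtain F S where f: "\<And>z. (Khat has_derivative (\<lambda>h. F z \<bullet> h)) (at z)"
    and F: "\<And>z. (F has_derivative S z) (at z)"
    and F_one: "\<And>z. F z \<bullet> 1 = 0"
    and S_one: "\<And>z. S z 1 = 0"
    and S_sym: "\<And>z h k. S z h \<bullet> k = S z k \<bullet> h"
    and S_nonneg: "\<And>z h. S z h \<bullet> h \<ge> 0"
    and S_const: "\<And>z h u v. S z h \<bullet> h = 0 \<Longrightarrow> h $ u = h $ v"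
    using reduced_function_derivatives[OF network assumption_A[unfolded K]]
    unfolding Khat K by metis
  have H: "fin_digraph H" "loopfree_digraph H" "verts H = UNIV"
    and pattern: "\<And>z i k. i \<noteq> k \<Longrightarrow> card {j \<in> arcs H. {tail H j, head H j} = {i, k}} =
        (if hessian Khat z $ i $ k \<noteq> 0 then 1 else 0)"
    using assumption_B by (auto simp: kron_reduced_graph_def)
  interpret fin_digraph H by fact
  interpret loopfree_digraph H by fact
  let ?A = "hessian Khat"
  define w where "w z j = - ?A z $ tail H j $ head H j" for z j
  have A: "?A z *v h = S z h" for z h
    using F[of z] has_derivative_linear[OF F, of z]
    by (simp add: hessian_def gradient_eqI[OF f] jacobian_def frechet_derivative_at[symmetric] matrix_works)
  have A_nth: "?A z $ i $ k = S z (axis k 1) \<bullet> axis i 1" for z i k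
    by (simp add: A[symmetric] inner_axis matrix_vector_mul_component row_def inner_axis')
  have S_laplacian: "S z = laplacian H (w z)" for z
  proof
    fix h
    have "?A z *v h = laplacian H (w z) h"
      unfolding w_def
      by (rule laplacian_of_pattern[OF _ _ finite_arcs no_loops pattern])
        (simp_all add: A S_one A_nth S_sym)
    then show "S z h = laplacian H (w z) h" by (simp add: A)
  qed
  have conn: "Digraph_Component.connected H"
    unfolding connected_iff_potentials_constant[OF H(2,3)]
  proof (intro allI impI)
    fix h :: "real ^ 'b" and u v
    assume "\<forall>j\<in>arcs H. edge_vector H j \<bullet> h = 0"
    then have "S 0 h \<bullet> h = 0" by (simp add: S_laplacian laplacian_inner)
    then show "h $ u = h $ v" by (rule S_const)
  qed
  have w: "w z j > 0" if j: "j \<in> arcs H" for z j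
  proof -
    obtain p where p: "\<And>k. k \<in> arcs H \<Longrightarrow> edge_vector H k \<bullet> p = (if k = j then 1 else 0)"
      using dual_potential_exists[OF finite_arcs H(3) kernel j] by blast
    have "S z p \<bullet> p = (\<Sum>k\<in>arcs H. if k = j then w z j else 0)"
      unfolding S_laplacian laplacian_inner by (rule sum.cong) (simp_all add: p)
    then have "S z p \<bullet> p = w z j" using j by simp
    moreover have "p $ head H j \<noteq> p $ tail H j"
      using p[OF j] edge_vector_inner[OF no_loops[OF j], of p] by simp
    ultimately show ?thesis using S_nonneg[of z p] S_const[of z p] by fastforce
  qed
  obtain gh where "nonlinear_network H gh"
    and "\<And>z. Khat z = (if arcs H = {} then Khat 0 else 0) + associated_function H gh z"
    using separable_if_hessian_laplacian[OF H conn kernel f F[unfolded S_laplacian] F_one w] by blast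
  moreover have "arcs H \<noteq> {}" if two: "2 \<le> CARD('b)"
  proof
    assume "arcs H = {}"
    then have const: "h $ u = h $ v" for h :: "real ^ 'b" and u v
      using conn unfolding connected_iff_potentials_constant[OF H(2,3)] by blast
    have "u = v" for u v :: 'b
      using const[of "axis u 1" u v] by (auto simp: axis_def split: if_splits)
    then have "CARD('b) \<le> 1" by (auto simp: card_le_Suc0_iff_eq)
    with two show False by simp
  qed
  ultimately show ?thesis by metis
qed

end
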